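(* Let $f:\mathbb{R}^n\to\mathbb{R}\cup\{\pm\infty\}$ be a function and let $\bar x\in\mathbb{R}^n$ be such that $f(\bar x)=0$. If $\mathbf{0}^*\in\mathrm{int}\,\hat\partial f(\bar x)$, then the following assertions are true: (i) $\bar x$ is a local sharp minimizer of $f$; (ii) $\bar x$ is superstable (for the family of problems $\min_{x\in\mathbb{R}^n}[f(x)+g(x)]$, $g\in\mathcal{G}_{\bar x}$); (iii) $f$ admits a local error bound at $\bar x$; (iv) there exists $\epsilon>0$ such that every function $\tilde f\in\mathrm{Ptb}(f,\bar x,\epsilon)$ with $\tilde f(\bar x)=0$ admits a local error bound at $\bar x$.
   Context: $\hat\partial f(\bar x)=\left\{x^*\in(\mathbb{R}^n)^*:\ \liminf_{x\to\bar x}\frac{f(x)-f(\bar x)-\langle x^*,x-\bar x\rangle}{\|x-\bar x\|}\ge0\right\}$ is the regular (Fréchet) subdifferential; $\mathbf{0}^*$ is the null vector of $(\mathbb{R}^n)^*$. $B(x,r)$ is the closed ball. Local sharp minimizer: there exist $\sigma>0$, $r>0$ such that $f(x)\ge f(\bar x)+\sigma\|x-\bar x\|$ for all $x\in B(\bar x,r)$. $\mathcal{G}_{\bar x}$ is the set of all functions $g:\mathbb{R}^n\to\mathbb{R}\cup\{\pm\infty\}$ with $|g(\bar x)|<\infty$. The strong slope of $g$ at $\bar x$ is $|\nabla g|(\bar x)=0$ if $\bar x$ is a local minimizer of $g$, and $|\nabla g|(\bar x)=\limsup_{x\to\bar x}\frac{g(\bar x)-g(x)}{\|x-\bar x\|}$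 otherwise. $\bar x$ is superstable if it is a local minimizer of $f$ and there exists $\epsilon_0>0$ such that $\bar x$ is a local minimizer of $f+g$ for every $g\in\mathcal{G}_{\bar x}$ with $|\nabla g|(\bar x)<\epsilon_0$. (Any fixed convention may be adopted for $(+\infty)+(-\infty)$ in $f+g$.) Write $[h\le0]=\{x: h(x)\le0\}$, $[r]_+=\max\{r,0\}$, $\mathrm{dist}(x,S)=\inf_{y\in S}\|x-y\|$. A function $h:\mathbb{R}^n\to\mathbb{R}\cup\{\pm\infty\}$ with $h(\bar x)=0$ admits a local error bound at $\bar x$ if there exist $c>0$, $r>0$ such that $\mathrm{dist}(x,[h\le0])\le c[h(x)]_+$ for all $x\in B(\bar x,r)$. $\mathrm{Ptb}(f,\bar x,\epsilon)=\left\{\tilde f\in\mathcal{G}_{\bar x}:\ \limsup_{x\to\bar x}\frac{|\tilde f(x)-f(x)-(\tilde f(\bar x)-f(\bar x))|}{\|x-\bar x\|}\le\epsilon\right\}$, where the difference $\tilde f(x)-f(x)$ of two equal infinite values is taken to be $0$. *)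

theory Defs
  imports "HOL-Analysis.Analysis"
begin

text \<open>
  Extended-real-valued functions are rendered as functions into \<open>ereal\<close>, and the dual of a normed
  space \<open>'a\<close> as \<open>'a \<Rightarrow>\<^sub>L real\<close> with the operator norm. In \<open>ereal\<close>, \<open>\<infinity> + (-\<infinity>) = \<infinity>\<close>; this is the
  convention used for the sum of two functions in \<open>superstable\<close>.
\<close>

text \<open>
  Here \<open>f xbar\<close> is meant to be finite, so that the subtractions are unambiguous. The filter
  \<open>at xbar\<close> excludes the point \<open>xbar\<close> itself, so the divisor is positive.
\<close>

definition regular_subdifferential ::
    "('a::real_normed_vector \<Rightarrow> ereal) \<Rightarrow> 'a \<Rightarrow> ('a \<Rightarrow>\<^sub>L real) set" where
  "regular_subdifferential f xbar =
     {xs. Liminf (at xbar)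
            (\<lambda>x. (f x - f xbar - ereal (blinfun_apply xs (x - xbar))) / ereal (norm (x - xbar))) \<ge> 0}"

definition local_minimizer :: "('a::real_normed_vector \<Rightarrow> ereal) \<Rightarrow> 'a \<Rightarrow> bool" where
  "local_minimizer f xbar \<longleftrightarrow> (\<exists>r>0. \<forall>x\<in>cball xbar r. f xbar \<le> f x)"

definition local_sharp_minimizer :: "('a::real_normed_vector \<Rightarrow> ereal) \<Rightarrow> 'a \<Rightarrow> bool" where
  "local_sharp_minimizer f xbar \<longleftrightarrow>
     (\<exists>\<sigma>::real>0. \<exists>r>0. \<forall>x\<in>cball xbar r. f x \<ge> f xbar + ereal (\<sigma> * norm (x - xbar)))"

definition finite_at :: "'a::real_normed_vector \<Rightarrow> ('a \<Rightarrow> ereal) set" where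
  "finite_at xbar = {g. \<bar>g xbar\<bar> < \<infinity>}"

definition strong_slope :: "('a::real_normed_vector \<Rightarrow> ereal) \<Rightarrow> 'a \<Rightarrow> ereal" where
  "strong_slope g xbar =
     (if local_minimizer g xbar then 0
      else Limsup (at xbar) (\<lambda>x. (g xbar - g x) / ereal (norm (x - xbar))))"

definition superstable :: "('a::real_normed_vector \<Rightarrow> ereal) \<Rightarrow> 'a \<Rightarrow> bool" where
  "superstable f xbar \<longleftrightarrow>
     local_minimizer f xbar \<and>
     (\<exists>\<epsilon>\<^sub>0::real>0. \<forall>g\<in>finite_at xbar.
        strong_slope g xbar < ereal \<epsilon>\<^sub>0 \<longrightarrow> local_minimizer (\<lambda>x. f x + g x) xbar)"

text \<open>
  Only meant for \<open>h xbar = 0\<close>: then the sublevel set is nonempty, and the library convention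
  \<open>infdist x {} = 0\<close> plays no role.
\<close>

definition local_error_bound :: "('a::real_normed_vector \<Rightarrow> ereal) \<Rightarrow> 'a \<Rightarrow> bool" where
  "local_error_bound h xbar \<longleftrightarrow>
     (\<exists>c::real>0. \<exists>r>0. \<forall>x\<in>cball xbar r.
        ereal (infdist x {y. h y \<le> 0}) \<le> ereal c * max (h x) 0)"

text \<open>
  Subtraction on \<open>ereal\<close> gives \<open>\<infinity>\<close> for two equal infinite values; here the value has to be \<open>0\<close>.
\<close>

definition ereal_diff :: "ereal \<Rightarrow> ereal \<Rightarrow> ereal" where
  "ereal_diff a b = (if a = b then 0 else a - b)"

definition Ptb :: "('a::real_normed_vector \<Rightarrow> ereal) \<Rightarrow> 'a \<Rightarrow> real \<Rightarrow> ('a \<Rightarrow> ereal) set" where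
  "Ptb f xbar \<epsilon> =
     {ft \<in> finite_at xbar.
        Limsup (at xbar)
          (\<lambda>x. \<bar>ereal_diff (ft x) (f x) - (ft xbar - f xbar)\<bar> / ereal (norm (x - xbar))) \<le> ereal \<epsilon>}"

end

theory Submission
  imports Defs
begin

text \<open>
  A neighbourhood of \<open>0\<close> in the subdifferential contains the finitely many functionals
  \<open>\<plusminus>\<delta> b\<close>, \<open>b\<close> a basis vector. The maximum of these is a multiple of the maximum norm, so
  equivalence of norms in finite dimension makes \<open>f\<close> grow at least linearly away from the point.
  Sharp minimality implies the other assertions and survives perturbations whose linear rate is
  smaller than the growth rate.
\<close>

lemma local_minimizer_iff_eventually:
  "local_minimizer f a \<longleftrightarrow> (\<forall>\<^sub>F x in at a. f a \<le> f x)"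
  by (auto simp: local_minimizer_def eventually_at_le Ball_def mem_cball dist_commute)

text \<open>At \<open>x = a\<close> the growth inequality reads \<open>0 \<le> 0\<close>, so passing
  to the punctured filter \<open>at a\<close> loses nothing.\<close>

lemma local_sharp_minimizer_iff_eventually:
  assumes "f a = 0"
  shows "local_sharp_minimizer f a \<longleftrightarrow>
    (\<exists>\<sigma>::real>0. \<forall>\<^sub>F x in at a. ereal (\<sigma> * norm (x - a)) \<le> f x)"
proof -
  have "(\<forall>x\<in>cball a r. f x \<ge> f a + ereal (\<sigma> * norm (x - a))) \<longleftrightarrow>
      (\<forall>x\<in>UNIV. x \<noteq> a \<and> dist x a \<le> r \<longrightarrow> ereal (\<sigma> * norm (x - a)) \<le> f x)" for \<sigma> r :: real
  proof -
    have "f x \<ge> f a + ereal (\<sigma> * norm (x - a)) \<longleftrightarrow>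
        (x \<noteq> a \<longrightarrow> ereal (\<sigma> * norm (x - a)) \<le> f x)" for x
      using assms by (cases "x = a") simp_all
    then show ?thesis
      by (simp add: mem_cball dist_commute Ball_def imp_conjL) blast
  qed
  then show ?thesis
    by (simp add: local_sharp_minimizer_def eventually_at_le)
qed

text \<open>A liminf that is at least 0 exceeds \<open>- \<eta>\<close> strictly, hence so do the
  quotients near \<open>a\<close>; multiplying by the norm gives the bound. The error term is the
  price for turning a liminf into an inequality on a neighbourhood.\<close>

lemma linear_growth_of_regular_subgradient:
  assumes "xs \<in> regular_subdifferential f a" "f a = 0" "\<eta> > 0"
  shows "\<forall>\<^sub>F x in at a. ereal (blinfun_apply xs (x - a) - \<eta> * norm (x - a)) \<le> f x"
proof -
  have "ereal (- \<eta>) < Liminf (at a)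
      (\<lambda>x. (f x - ereal (blinfun_apply xs (x - a))) / ereal (norm (x - a)))"
    by (rule less_le_trans [of _ 0]) (use assms in \<open>simp_all add: regular_subdifferential_def\<close>)
  then have "\<forall>\<^sub>F x in at a.
      ereal (- \<eta>) < (f x - ereal (blinfun_apply xs (x - a))) / ereal (norm (x - a))"
    by (rule less_LiminfD)
  moreover have "\<forall>\<^sub>F x in at a. x \<noteq> a"
    by (simp add: eventually_at_filter)
  ultimately show ?thesis
  proof eventually_elim
    case (elim x)
    then show ?case
      by (cases "f x") (auto simp: field_simps)
  qed
qed

lemma local_sharp_minimizer_of_interior_subdifferential:
  fixes f :: "'a::euclidean_space \<Rightarrow> ereal"
  assumes "f a = 0" "0 \<in> interior (regular_subdifferential f a)"
  shows "local_sharp_minimizer f a"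
proof -
  obtain \<delta> where \<delta>: "\<delta> > 0" "cball 0 \<delta> \<subseteq> regular_subdifferential f a"
    using assms(2) by (auto simp: mem_interior_cball)
  \<comment> \<open>Some \<open>\<plusminus>\<delta> b\<close> reaches at least
    \<open>2 * \<sigma>\<close> times the norm of the displacement; the factor 2 leaves the rate
    \<open>\<sigma>\<close> after the error term with \<open>\<eta> = \<sigma>\<close> is
    paid.\<close>
  define \<sigma> where "\<sigma> = \<delta> / (2 * real DIM('a))"
  have \<sigma>: "\<sigma> > 0"
    using \<delta>(1) by (simp add: \<sigma>_def)
  have grow: "\<forall>\<^sub>F x in at a. ereal (v \<bullet> (x - a) - \<sigma> * norm (x - a)) \<le> f x"
    if "norm v \<le> \<delta>" for v :: 'a
  proof -
    have "norm (blinfun_inner_left v) \<le> norm v"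
      by (rule norm_blinfun_bound)
        (auto simp: Cauchy_Schwarz_ineq2 inner_commute mult.commute)
    then have "blinfun_inner_left v \<in> regular_subdifferential f a"
      using \<delta>(2) that by (auto simp: mem_cball)
    then show ?thesis
      using linear_growth_of_regular_subgradient [of "blinfun_inner_left v" f a \<sigma>] assms(1) \<sigma>
      by (simp add: inner_commute [of v])
  qed
  \<comment> \<open>The neighbourhood in \<open>grow\<close> depends on \<open>v\<close>; a common
    one exists because only finitely many \<open>v\<close> are used.\<close>
  have "\<forall>\<^sub>F x in at a. \<forall>b\<in>Basis.
      ereal ((\<delta> *\<^sub>R b) \<bullet> (x - a) - \<sigma> * norm (x - a)) \<le> f x \<and>
      ereal ((- \<delta> *\<^sub>R b) \<bullet> (x - a) - \<sigma> * norm (x - a)) \<le> f x"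
    using \<delta>(1) by (intro eventually_ball_finite ballI eventually_conj grow) auto
  then have "\<forall>\<^sub>F x in at a. ereal (\<sigma> * norm (x - a)) \<le> f x"
  proof eventually_elim
    case (elim x)
    define h where "h = x - a"
    \<comment> \<open>If all coordinates were smaller than the average
      \<open>norm h / DIM('a)\<close>, the sum of their absolute values would be below
      \<open>norm h\<close>, which it bounds from above.\<close>
    have "\<exists>b\<in>Basis. norm h \<le> real DIM('a) * \<bar>h \<bullet> b\<bar>"
    proof (rule ccontr)
      assume "\<not> ?thesis"
      then have "\<bar>h \<bullet> b\<bar> < norm h / real DIM('a)" if "b \<in> Basis" for b
        using that by (auto simp: field_simps)
      then have "(\<Sum>b\<in>Basis. \<bar>h \<bullet> b\<bar>) < (\<Sum>b\<in>(Basis::'a set). norm h / real DIM('a))"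
        by (intro sum_strict_mono) auto
      then show False
        using norm_le_l1 [of h] by simp
    qed
    then obtain b where b: "b \<in> Basis" "norm h \<le> real DIM('a) * \<bar>h \<bullet> b\<bar>"
      by blast
    have "2 * \<sigma> * norm h \<le> \<delta> * \<bar>h \<bullet> b\<bar>"
      using b(2) \<delta>(1) by (simp add: \<sigma>_def field_simps)
    \<comment> \<open>The sign of \<open>h \<bullet> b\<close> decides which of the two functionals
      does the work.\<close>
    then have "\<sigma> * norm h \<le> \<delta> * (h \<bullet> b) - \<sigma> * norm h \<or> \<sigma> * norm h \<le> - \<delta> * (h \<bullet> b) - \<sigma> * norm h"
      by (auto simp: abs_if split: if_splits)
    moreover have "ereal (\<delta> * (h \<bullet> b) - \<sigma> * norm h) \<le> f x" "ereal (- \<delta> * (h \<bullet> b) - \<sigma> * norm h) \<le> f x"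
      using elim b(1) by (auto simp: h_def inner_commute)
    ultimately show ?case
      unfolding h_def by (meson ereal_less_eq(3) order_trans)
  qed
  then show ?thesis
    using \<sigma> local_sharp_minimizer_iff_eventually [of f a] assms(1) by blast
qed

text \<open>A slope below \<open>\<sigma>\<close> means that \<open>g\<close> falls more slowly than
  \<open>f\<close> rises, so the threshold is the growth rate itself.\<close>

lemma superstable_of_local_sharp_minimizer:
  assumes "local_sharp_minimizer f a" "f a = 0"
  shows "superstable f a"
proof -
  obtain \<sigma> :: real where \<sigma>: "\<sigma> > 0" "\<forall>\<^sub>F x in at a. ereal (\<sigma> * norm (x - a)) \<le> f x"
    using assms local_sharp_minimizer_iff_eventually by blast
  have nonneg: "\<forall>\<^sub>F x in at a. 0 \<le> f x"
    using \<sigma>(2)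
  proof eventually_elim
    case (elim x)
    have "0 \<le> ereal (\<sigma> * norm (x - a))"
      using \<sigma>(1) by simp
    then show ?case
      using elim by (rule order_trans)
  qed
  have "local_minimizer (\<lambda>x. f x + g x) a"
    if g: "g \<in> finite_at a" "strong_slope g a < ereal \<sigma>" for g
  proof (cases "local_minimizer g a")
    case True
    then have "\<forall>\<^sub>F x in at a. g a \<le> g x"
      by (simp add: local_minimizer_iff_eventually)
    with nonneg show ?thesis
      unfolding local_minimizer_iff_eventually
      by eventually_elim (use assms(2) add_mono in fastforce)
  next
    case False
    with g(2) have "\<forall>\<^sub>F x in at a. (g a - g x) / ereal (norm (x - a)) < ereal \<sigma>"
      by (intro Limsup_lessD) (simp add: strong_slope_def)
    moreover have "\<forall>\<^sub>F x in at a. x \<noteq> a"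
      by (simp add: eventually_at_filter)
    ultimately show ?thesis
      using \<sigma>(2) unfolding local_minimizer_iff_eventually
    proof eventually_elim
      case (elim x)
      obtain r where r: "g a = ereal r"
        using g(1) by (auto simp: finite_at_def)
      with elim show ?case
        \<comment> \<open>The strict slope bound excludes \<open>g x = -\<infinity>\<close>, so the
          convention for \<open>\<infinity> + (-\<infinity>)\<close> is never invoked.\<close>
        by (cases "f x"; cases "g x") (auto simp: assms(2) field_simps)
    qed
  qed
  then show ?thesis
    using \<sigma>(1) nonneg assms(2) by (auto simp: superstable_def local_minimizer_iff_eventually)
qed

text \<open>Since \<open>a\<close> lies in the sublevel set, the distance to that set is at most
  \<open>norm (x - a)\<close>, which sharpness bounds by \<open>f x / \<sigma>\<close>.\<close>

lemma local_error_bound_of_local_sharp_minimizer: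
  assumes "local_sharp_minimizer f a" "f a = 0"
  shows "local_error_bound f a"
proof -
  obtain \<sigma> r :: real where \<sigma>: "\<sigma> > 0" and r: "r > 0"
    and sharp: "\<And>x. x \<in> cball a r \<Longrightarrow> ereal (\<sigma> * norm (x - a)) \<le> f x"
    using assms by (auto simp: local_sharp_minimizer_def)
  have "ereal (infdist x {y. f y \<le> 0}) \<le> ereal (1 / \<sigma>) * max (f x) 0" if "x \<in> cball a r" for x
  proof -
    have "infdist x {y. f y \<le> 0} \<le> norm (x - a)"
      using assms(2) by (simp add: infdist_le flip: dist_norm)
    then have "ereal (infdist x {y. f y \<le> 0}) \<le> ereal (1 / \<sigma>) * ereal (\<sigma> * norm (x - a))"
      using \<sigma> by simp
    also have "\<dots> \<le> ereal (1 / \<sigma>) * max (f x) 0"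
      using sharp [OF that] \<sigma> by (intro ereal_mult_left_mono) (auto simp: le_max_iff_disj)
    finally show ?thesis .
  qed
  moreover have "1 / \<sigma> > 0"
    using \<sigma> by simp
  ultimately show ?thesis
    using r unfolding local_error_bound_def by blast
qed

lemma local_sharp_minimizer_perturbation:
  assumes "local_sharp_minimizer f a" "f a = 0"
  obtains \<epsilon> :: real where "\<epsilon> > 0"
    "\<And>ft. ft \<in> Ptb f a \<epsilon> \<Longrightarrow> ft a = 0 \<Longrightarrow> local_sharp_minimizer ft a"
proof -
  obtain \<sigma> :: real where \<sigma>: "\<sigma> > 0" "\<forall>\<^sub>F x in at a. ereal (\<sigma> * norm (x - a)) \<le> f x"
    using assms local_sharp_minimizer_iff_eventually by blast
  \<comment> \<open>\<open>Ptb\<close> bounds the limsup only weakly. Taking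
    \<open>\<sigma> / 3\<close> leaves room for the strict bound \<open>\<sigma> / 2\<close> on the
    quotients themselves, and \<open>ft\<close> keeps the rate \<open>\<sigma> / 2\<close>.\<close>
  have "local_sharp_minimizer ft a" if ft: "ft \<in> Ptb f a (\<sigma> / 3)" "ft a = 0" for ft
  proof -
    have "Limsup (at a) (\<lambda>x. \<bar>ereal_diff (ft x) (f x)\<bar> / ereal (norm (x - a))) \<le> ereal (\<sigma> / 3)"
      using ft assms(2) by (simp add: Ptb_def)
    also have "\<dots> < ereal (\<sigma> / 2)"
      using \<sigma>(1) by simp
    finally have "\<forall>\<^sub>F x in at a. \<bar>ereal_diff (ft x) (f x)\<bar> / ereal (norm (x - a)) < ereal (\<sigma> / 2)"
      by (rule Limsup_lessD)
    moreover have "\<forall>\<^sub>F x in at a. x \<noteq> a"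
      by (simp add: eventually_at_filter)
    ultimately have "\<forall>\<^sub>F x in at a. ereal (\<sigma> / 2 * norm (x - a)) \<le> ft x"
      using \<sigma>(2)
    proof eventually_elim
      case (elim x)
      have n: "0 < norm (x - a)" "\<sigma> / 2 * norm (x - a) \<le> \<sigma> * norm (x - a)"
        using elim(2) \<sigma>(1) by simp_all
      show ?case
      \<comment> \<open>Equal values, possibly both infinite, inherit the growth of \<open>f\<close>
        directly. For distinct values \<open>ereal_diff\<close> is true subtraction, and its bound
        forces both to be finite.\<close>
      proof (cases "ft x = f x")
        case True
        then show ?thesis
          using elim(3) n(2) by (metis ereal_less_eq(3) order_trans)
      next
        case False
        then show ?thesis
          using elim n(1)
          by (cases "f x"; cases "ft x") (auto simp: ereal_diff_def field_simps abs_if split: if_splits)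
      qed
    qed
    then show ?thesis
      using half_gt_zero [OF \<sigma>(1)] local_sharp_minimizer_iff_eventually [of ft a] ft(2) by blast
  qed
  then show thesis
    using that [of "\<sigma> / 3"] \<sigma>(1) by simp
qed

theorem theorem5:
  fixes f :: "real ^ 'n \<Rightarrow> ereal" and xbar :: "real ^ 'n"
  assumes "f xbar = 0"
    and "0 \<in> interior (regular_subdifferential f xbar)"
  shows "local_sharp_minimizer f xbar
    \<and> superstable f xbar
    \<and> local_error_bound f xbar
    \<and> (\<exists>\<epsilon>::real>0. \<forall>ft\<in>Ptb f xbar \<epsilon>. ft xbar = 0 \<longrightarrow> local_error_bound ft xbar)"
proof -
  have sharp: "local_sharp_minimizer f xbar"
    using assms by (rule local_sharp_minimizer_of_interior_subdifferential)
  \<comment> \<open>The error bound is not perturbed directly: sharp minimality passes to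
    \<open>ft\<close> and yields the error bound there.\<close>
  moreover have "\<exists>\<epsilon>::real>0. \<forall>ft\<in>Ptb f xbar \<epsilon>. ft xbar = 0 \<longrightarrow> local_error_bound ft xbar"
    using local_sharp_minimizer_perturbation [OF sharp assms(1)]
      local_error_bound_of_local_sharp_minimizer by metis
  ultimately show ?thesis
    using assms(1) superstable_of_local_sharp_minimizer local_error_bound_of_local_sharp_minimizer
    by blast
qed

end
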